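(* Let $n\ge 1$, let $t_1,\ldots,t_n$ be nonnegative real numbers with $\sum_{i=1}^n t_i=1$, and let $\alpha,\alpha_1,\ldots,\alpha_n$ be real numbers. If $\alpha^2 \geq \sum_{i=1}^n t_i\alpha_i^2$, then $$\prod_{i=1}^n \left(T_{\alpha_i}(x)\right)^{t_i} \leq T_\alpha(x)\quad\text{for all } x\geq 1,$$ where (for a given $x\ge 1$) equality occurs if and only if $x=1$ or $|\alpha|=|\alpha_i|$ for all $1\leq i\leq n$ with $t_i\neq 0$. Conversely, if the inequality $\prod_{i=1}^n (T_{\alpha_i}(x))^{t_i} \leq T_\alpha(x)$ holds for all $x\geq 1$, then $\alpha^2 \geq \sum_{i=1}^n t_i\alpha_i^2$.
   Context: For $\alpha\in\mathbb{R}$, the generalized Chebyshev function $T_\alpha:[1,\infty)\to[1,\infty)$ is defined by $$T_\alpha(x)=\frac12\left(x-\sqrt{x^2-1}\right)^\alpha+\frac12\left(x+\sqrt{x^2-1}\right)^\alpha,\quad x\ge 1;$$ equivalently, $T_\alpha\left(\frac{u+u^{-1}}{2}\right)=\frac{u^\alpha+u^{-\alpha}}{2}$ for all $u>0$. *)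

theory Defs
  imports Complex_Main
begin

(* The generalized Chebyshev function is meant on the domain {1..}; there both
   bases of powr are positive. Values for x < 1 carry no meaning. *)
definition gen_cheb :: "real \<Rightarrow> real \<Rightarrow> real" where
  "gen_cheb \<alpha> x =
     1/2 * (x - sqrt (x\<^sup>2 - 1)) powr \<alpha> + 1/2 * (x + sqrt (x\<^sup>2 - 1)) powr \<alpha>"

end

theory Submission
  imports Defs "HOL-Real_Asymp.Real_Asymp"
begin

text \<open>
  Write \<open>x = cosh s\<close> with \<open>s \<ge> 0\<close>; then \<open>T\<^sub>a(x) = cosh (a s)\<close>.  After taking logarithms, the
  inequality compares a weighted mean of the numbers \<open>ln (cosh (\<alpha>\<^sub>i s))\<close> with \<open>ln (cosh (\<alpha> s))\<close>,
  and the hypothesis on the squares suggests regarding both as values of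
  \<open>g(y) = ln (cosh (sqrt y))\<close>, at \<open>y = (\<alpha>\<^sub>i s)\<^sup>2\<close> and \<open>y = (\<alpha> s)\<^sup>2\<close>.
  The function \<open>g\<close> is strictly concave and increasing, because its derivative
  \<open>tanh (sqrt y) / (2 sqrt y)\<close> is positive and strictly decreasing
  (\<open>tanh_over_self_strict_decreasing\<close>).
  So \<open>g\<close> lies below its tangent at \<open>(\<alpha> s)\<^sup>2\<close> and touches it only there (\<open>ln_cosh_less_tangent\<close>);
  averaging this tangent bound over \<open>i\<close> gives the inequality together with the equality case.

  For the converse, \<open>ln (cosh (a s))\<close> behaves like \<open>(a s)\<^sup>2 / 2\<close> as \<open>s\<close> tends to \<open>0\<close>
  (\<open>ln_cosh_quadratic_limit\<close>), so that dividing the logarithmic inequality by \<open>s\<^sup>2\<close> and letting \<open>s\<close> tend to \<open>0\<close>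
  leaves exactly the inequality between the squares.
\<close>

lemma gen_cheb_cosh:
  assumes "s \<ge> 0"
  shows "gen_cheb a (cosh s) = cosh (a * s)"
proof -
  have "sqrt ((cosh s)\<^sup>2 - 1) = sinh s"
    using assms by (simp add: cosh_square_eq)
  moreover have "cosh s - sinh s = exp (- s)" "cosh s + sinh s = exp s"
    by (simp_all add: cosh_minus_sinh cosh_plus_sinh)
  ultimately show ?thesis
    by (simp only: gen_cheb_def) (simp add: exp_powr_real cosh_field_def mult.commute add.commute)
qed

lemma tanh_over_self_strict_decreasing:
  fixes a b :: real
  assumes "0 < a" "a < b"
  shows "tanh b / b < tanh a / a"
proof (rule DERIV_neg_imp_decreasing[OF assms(2)])
  fix x assume "a \<le> x" "x \<le> b"
  then have x: "x > 0" using assms by simp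
  \<comment> \<open>The numerator of the derivative is minus \<open>p(x) = tanh x - x (1 - tanh\<^sup>2 x)\<close>, which vanishes
     at \<open>0\<close> and increases.\<close>
  have "tanh 0 - 0 * (1 - (tanh 0)\<^sup>2) < tanh x - x * (1 - (tanh x)\<^sup>2)"
  proof (rule DERIV_pos_imp_increasing_open[OF x])
    fix y :: real assume y: "0 < y" "y < x"
    have "((\<lambda>y. tanh y - y * (1 - (tanh y)\<^sup>2)) has_real_derivative
             2 * y * tanh y * (1 - (tanh y)\<^sup>2)) (at y)"
      by (auto intro!: derivative_eq_intros simp: algebra_simps power2_eq_square)
    moreover have "(tanh y)\<^sup>2 < 1"
      using tanh_real_bounds[of y] by (auto simp: abs_square_less_1)
    ultimately show "\<exists>d. ((\<lambda>y. tanh y - y * (1 - (tanh y)\<^sup>2)) has_real_derivative d) (at y) \<and> 0 < d"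
      using y by (intro exI[of _ "2 * y * tanh y * (1 - (tanh y)\<^sup>2)"]) simp
  qed (auto intro!: continuous_intros)
  then have "x * (1 - (tanh x)\<^sup>2) - tanh x < 0" by simp
  then have "(x * (1 - (tanh x)\<^sup>2) - tanh x) / x\<^sup>2 < 0"
    using x by (simp add: divide_neg_pos)
  moreover have "((\<lambda>x. tanh x / x) has_real_derivative (x * (1 - (tanh x)\<^sup>2) - tanh x) / x\<^sup>2) (at x)"
    using x by (auto intro!: derivative_eq_intros simp: field_simps power2_eq_square)
  ultimately show "\<exists>d. ((\<lambda>x. tanh x / x) has_real_derivative d) (at x) \<and> d < 0" by blast
qed

text \<open>
  In terms of \<open>y = c\<^sup>2\<close> the right-hand side is the tangent to \<open>ln (cosh (sqrt y))\<close> at \<open>y = b\<^sup>2\<close>.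
  Working with \<open>c\<close> avoids the square root, which is not differentiable at \<open>0\<close>: for \<open>c > 0\<close>
  the right-hand side minus the left-hand side has derivative \<open>c (tanh b / b - tanh c / c)\<close>, which is negative to the left and
  positive to the right of its zero \<open>c = b\<close>.
\<close>

lemma ln_cosh_less_tangent:
  fixes b c :: real
  assumes b: "b > 0" and ne: "\<bar>c\<bar> \<noteq> b"
  shows "ln (cosh c) < ln (cosh b) + tanh b / (2 * b) * (c\<^sup>2 - b\<^sup>2)"
proof -
  define h where "h = (\<lambda>c. tanh b / (2 * b) * (c\<^sup>2 - b\<^sup>2) - ln (cosh c))"
  define h' where "h' = (\<lambda>c. tanh b / b * c - tanh c)"
  have h: "(h has_real_derivative h' c) (at c)" for c
    unfolding h_def h'_def using b
    by (auto intro!: derivative_eq_intros simp: tanh_def)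
  have "h b < h \<bar>c\<bar>"
  proof (cases "\<bar>c\<bar> < b")
    case True
    then obtain z where z: "\<bar>c\<bar> < z" "z < b" "h b - h \<bar>c\<bar> = (b - \<bar>c\<bar>) * h' z"
      using MVT2[of "\<bar>c\<bar>" b h h'] h by blast
    then have "h' z < 0"
      using tanh_over_self_strict_decreasing[of z b] by (simp add: h'_def field_simps)
    then have "h b - h \<bar>c\<bar> < 0" using z by (simp add: mult_pos_neg)
    then show ?thesis by simp
  next
    case False
    then have "b < \<bar>c\<bar>" using ne by simp
    then obtain z where z: "b < z" "z < \<bar>c\<bar>" "h \<bar>c\<bar> - h b = (\<bar>c\<bar> - b) * h' z"
      using MVT2[of b "\<bar>c\<bar>" h h'] h by blast
    then have "h' z > 0"
      using tanh_over_self_strict_decreasing[of b z] b by (simp add: h'_def field_simps)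
    then have "h \<bar>c\<bar> - h b > 0" using z by simp
    then show ?thesis by simp
  qed
  then show ?thesis by (simp add: h_def)
qed

text \<open>
  Averaging the tangent bound leaves the slope, which is positive, times
  \<open>(\<Sum>i\<in>I. t i * (c i)\<^sup>2) - b\<^sup>2 \<le> 0\<close>.
\<close>

lemma mean_ln_cosh_less:
  fixes t c :: "'i \<Rightarrow> real"
  assumes I: "finite I" and t: "\<And>i. i \<in> I \<Longrightarrow> t i \<ge> 0" "sum t I = 1"
    and b: "b > 0" and le: "(\<Sum>i\<in>I. t i * (c i)\<^sup>2) \<le> b\<^sup>2"
    and j: "j \<in> I" "t j \<noteq> 0" "\<bar>c j\<bar> \<noteq> b"
  shows "(\<Sum>i\<in>I. t i * ln (cosh (c i))) < ln (cosh b)"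
proof -
  define k where "k = tanh b / (2 * b)"
  have k: "k > 0" using b by (simp add: k_def)
  have "(\<Sum>i\<in>I. t i * ln (cosh (c i))) < (\<Sum>i\<in>I. t i * (ln (cosh b) + k * ((c i)\<^sup>2 - b\<^sup>2)))"
  proof (rule sum_strict_mono_strong[OF I j(1)])
    show "t j * ln (cosh (c j)) < t j * (ln (cosh b) + k * ((c j)\<^sup>2 - b\<^sup>2))"
      using ln_cosh_less_tangent[OF b j(3)] t(1)[OF j(1)] j(2) by (simp add: k_def)
  next
    fix i assume i: "i \<in> I"
    have "ln (cosh (c i)) \<le> ln (cosh b) + k * ((c i)\<^sup>2 - b\<^sup>2)"
    proof (cases "\<bar>c i\<bar> = b")
      case True
      then have "cosh (c i) = cosh b" "(c i)\<^sup>2 = b\<^sup>2"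
        by (metis cosh_real_abs, metis power2_abs)
      then show ?thesis by (simp only:) simp
    next
      case False
      then show ?thesis using ln_cosh_less_tangent[OF b, of "c i"] by (simp add: k_def)
    qed
    then show "t i * ln (cosh (c i)) \<le> t i * (ln (cosh b) + k * ((c i)\<^sup>2 - b\<^sup>2))"
      using t(1)[OF i] by (rule mult_left_mono)
  qed
  also have "\<dots> = (\<Sum>i\<in>I. (ln (cosh b) - k * b\<^sup>2) * t i + k * (t i * (c i)\<^sup>2))"
    by (rule sum.cong) (auto simp: algebra_simps)
  also have "\<dots> = ln (cosh b) + k * ((\<Sum>i\<in>I. t i * (c i)\<^sup>2) - b\<^sup>2)"
    unfolding sum.distrib sum_distrib_left[symmetric] t(2) by (simp add: algebra_simps)
  also have "\<dots> \<le> ln (cosh b)"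
    using k le by (simp add: mult_nonneg_nonpos)
  finally show ?thesis .
qed

lemma ln_cosh_quadratic_limit:
  fixes a :: real
  shows "((\<lambda>s. ln (cosh (a * s)) / s\<^sup>2) \<longlongrightarrow> a\<^sup>2 / 2) (at_right 0)"
proof -
  have pos: "((\<lambda>s. ln (cosh (a * s)) / s\<^sup>2) \<longlongrightarrow> a\<^sup>2 / 2) (at_right 0)" if "a > 0" for a :: real
    using that unfolding cosh_field_def power2_eq_square by real_asymp
  consider "a > 0" | "a = 0" | "- a > 0" by linarith
  then show ?thesis
    using pos[of a] pos[of "- a"] by cases auto
qed

lemma prod_powr_eq_exp_sum_ln:
  fixes f t :: "'i \<Rightarrow> real"
  assumes "finite I" "\<And>i. i \<in> I \<Longrightarrow> f i > 0"
  shows "(\<Prod>i\<in>I. f i powr t i) = exp (\<Sum>i\<in>I. t i * ln (f i))"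
proof -
  have "(\<Prod>i\<in>I. f i powr t i) = (\<Prod>i\<in>I. exp (t i * ln (f i)))"
    using assms(2) by (intro prod.cong) (auto simp: powr_def less_imp_neq[symmetric])
  then show ?thesis by (simp add: exp_sum assms(1))
qed

lemma prod_gen_cheb_cosh:
  assumes "s \<ge> 0" "finite I"
  shows "(\<Prod>i\<in>I. gen_cheb (a i) (cosh s) powr t i) = exp (\<Sum>i\<in>I. t i * ln (cosh (a i * s)))"
  using assms by (simp add: gen_cheb_cosh prod_powr_eq_exp_sum_ln)

text \<open>
  If all \<open>\<bar>a i\<bar>\<close> of nonzero weight agree with \<open>\<bar>\<alpha>\<bar>\<close>, both sides are the same.  Otherwise
  \<open>\<alpha> \<noteq> 0\<close>, since \<open>\<alpha> = 0\<close> would force every \<open>a i\<close> of nonzero weight to vanish, and so for \<open>s > 0\<close> the strict bound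
  applies with \<open>b = \<bar>\<alpha>\<bar> s > 0\<close>.
\<close>

lemma mean_ln_cosh_le:
  fixes t a :: "'i \<Rightarrow> real"
  assumes I: "finite I" and t: "\<And>i. i \<in> I \<Longrightarrow> t i \<ge> 0" "sum t I = 1"
    and le: "(\<Sum>i\<in>I. t i * (a i)\<^sup>2) \<le> \<alpha>\<^sup>2" and s: "s \<ge> 0"
  defines "M \<equiv> (\<Sum>i\<in>I. t i * ln (cosh (a i * s)))"
  shows "M \<le> ln (cosh (\<alpha> * s))"
    and "M = ln (cosh (\<alpha> * s)) \<longleftrightarrow> s = 0 \<or> (\<forall>i\<in>I. t i \<noteq> 0 \<longrightarrow> \<bar>\<alpha>\<bar> = \<bar>a i\<bar>)"
proof -
  have eq: "M = ln (cosh (\<alpha> * s))" if E: "s = 0 \<or> (\<forall>i\<in>I. t i \<noteq> 0 \<longrightarrow> \<bar>\<alpha>\<bar> = \<bar>a i\<bar>)"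
  proof -
    have "t i * ln (cosh (a i * s)) = t i * ln (cosh (\<alpha> * s))" if i: "i \<in> I" for i
    proof (cases "t i = 0 \<or> s = 0")
      case False
      then have "\<bar>a i * s\<bar> = \<bar>\<alpha> * s\<bar>" using E i by (simp add: abs_mult)
      then have "cosh (a i * s) = cosh (\<alpha> * s)" by (metis cosh_real_abs)
      then show ?thesis by simp
    qed auto
    then have "M = (\<Sum>i\<in>I. t i * ln (cosh (\<alpha> * s)))" unfolding M_def by (rule sum.cong[OF refl])
    then show ?thesis by (simp add: sum_distrib_right[symmetric] t(2))
  qed
  have less: "M < ln (cosh (\<alpha> * s))" if E: "\<not> (s = 0 \<or> (\<forall>i\<in>I. t i \<noteq> 0 \<longrightarrow> \<bar>\<alpha>\<bar> = \<bar>a i\<bar>))"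
  proof -
    obtain j where j: "j \<in> I" "t j \<noteq> 0" "\<bar>a j\<bar> \<noteq> \<bar>\<alpha>\<bar>" and s0: "s > 0" using E s by auto
    have "\<alpha> \<noteq> 0"
    proof
      assume "\<alpha> = 0"
      then have "(\<Sum>i\<in>I. t i * (a i)\<^sup>2) = 0"
        using le t(1) by (intro antisym sum_nonneg) auto
      then have "t j * (a j)\<^sup>2 = 0"
        using sum_nonneg_eq_0_iff[OF I, of "\<lambda>i. t i * (a i)\<^sup>2"] t(1) j(1) by simp
      then show False using j \<open>\<alpha> = 0\<close> by simp
    qed
    have "(\<Sum>i\<in>I. t i * (a i * s)\<^sup>2) = (\<Sum>i\<in>I. t i * (a i)\<^sup>2) * s\<^sup>2"
      by (simp add: sum_distrib_right power_mult_distrib mult.assoc)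
    also have "\<dots> \<le> (\<bar>\<alpha>\<bar> * s)\<^sup>2"
      using le by (simp add: power_mult_distrib mult_right_mono)
    finally have "M < ln (cosh (\<bar>\<alpha>\<bar> * s))"
      unfolding M_def using s0 j \<open>\<alpha> \<noteq> 0\<close>
      by (intro mean_ln_cosh_less[OF I t, where j = j]) (auto simp: abs_mult)
    also have "cosh (\<bar>\<alpha>\<bar> * s) = cosh (\<alpha> * s)"
      using s0 by (metis abs_mult abs_of_pos cosh_real_abs)
    finally show ?thesis .
  qed
  show "M \<le> ln (cosh (\<alpha> * s))"
    using eq less by linarith
  show "M = ln (cosh (\<alpha> * s)) \<longleftrightarrow> s = 0 \<or> (\<forall>i\<in>I. t i \<noteq> 0 \<longrightarrow> \<bar>\<alpha>\<bar> = \<bar>a i\<bar>)"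
    using eq less by (metis less_irrefl)
qed

lemma squares_le_of_mean_ln_cosh_le:
  fixes t a :: "'i \<Rightarrow> real"
  assumes le: "\<And>s. s > 0 \<Longrightarrow> (\<Sum>i\<in>I. t i * ln (cosh (a i * s))) \<le> ln (cosh (\<alpha> * s))"
  shows "(\<Sum>i\<in>I. t i * (a i)\<^sup>2) \<le> \<alpha>\<^sup>2"
proof -
  have "(\<Sum>i\<in>I. t i * ((a i)\<^sup>2 / 2)) \<le> \<alpha>\<^sup>2 / 2"
  proof (rule tendsto_le)
    show "((\<lambda>s. ln (cosh (\<alpha> * s)) / s\<^sup>2) \<longlongrightarrow> \<alpha>\<^sup>2 / 2) (at_right 0)"
      by (rule ln_cosh_quadratic_limit)
    show "((\<lambda>s. \<Sum>i\<in>I. t i * (ln (cosh (a i * s)) / s\<^sup>2)) \<longlongrightarrow> (\<Sum>i\<in>I. t i * ((a i)\<^sup>2 / 2))) (at_right 0)"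
      by (intro tendsto_intros ln_cosh_quadratic_limit)
    have "(\<Sum>i\<in>I. t i * (ln (cosh (a i * s)) / s\<^sup>2)) \<le> ln (cosh (\<alpha> * s)) / s\<^sup>2" if "s > 0" for s
      using divide_right_mono[OF le[OF that], of "s\<^sup>2"] by (simp add: sum_divide_distrib)
    then show "\<forall>\<^sub>F s in at_right 0. (\<Sum>i\<in>I. t i * (ln (cosh (a i * s)) / s\<^sup>2)) \<le> ln (cosh (\<alpha> * s)) / s\<^sup>2"
      by (auto simp: eventually_at_right_field intro: exI[of _ 1])
  qed simp
  then show ?thesis by (simp add: sum_divide_distrib[symmetric])
qed

theorem theorem1:
  fixes n :: nat and t :: "nat \<Rightarrow> real" and \<alpha> :: real and \<alpha>s :: "nat \<Rightarrow> real"
  assumes "n \<ge> 1"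
    and "\<forall>i\<in>{1..n}. t i \<ge> 0"
    and "(\<Sum>i=1..n. t i) = 1"
  shows
    "(\<alpha>\<^sup>2 \<ge> (\<Sum>i=1..n. t i * (\<alpha>s i)\<^sup>2) \<longrightarrow>
        (\<forall>x\<ge>1. (\<Prod>i=1..n. gen_cheb (\<alpha>s i) x powr t i) \<le> gen_cheb \<alpha> x \<and>
               ((\<Prod>i=1..n. gen_cheb (\<alpha>s i) x powr t i) = gen_cheb \<alpha> x \<longleftrightarrow>
                  x = 1 \<or> (\<forall>i\<in>{1..n}. t i \<noteq> 0 \<longrightarrow> \<bar>\<alpha>\<bar> = \<bar>\<alpha>s i\<bar>)))) \<and>
     ((\<forall>x\<ge>1. (\<Prod>i=1..n. gen_cheb (\<alpha>s i) x powr t i) \<le> gen_cheb \<alpha> x) \<longrightarrow>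
        \<alpha>\<^sup>2 \<ge> (\<Sum>i=1..n. t i * (\<alpha>s i)\<^sup>2))"
proof -
  define M where "M = (\<lambda>s. \<Sum>i=1..n. t i * ln (cosh (\<alpha>s i * s)))"
  have lhs: "(\<Prod>i=1..n. gen_cheb (\<alpha>s i) (cosh s) powr t i) = exp (M s)" if "s \<ge> 0" for s
    using that by (simp add: M_def prod_gen_cheb_cosh)
  have rhs: "gen_cheb \<alpha> (cosh s) = exp (ln (cosh (\<alpha> * s)))" if "s \<ge> 0" for s
    using that by (simp add: gen_cheb_cosh)
  show ?thesis
  proof (intro conjI impI allI)
    fix x :: real
    assume le: "\<alpha>\<^sup>2 \<ge> (\<Sum>i=1..n. t i * (\<alpha>s i)\<^sup>2)" and "x \<ge> 1"
    then obtain s where s: "s \<ge> 0" "x = cosh s"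
      by (metis arcosh_nonneg_real cosh_arcosh_real)
    have mean: "M s \<le> ln (cosh (\<alpha> * s))"
      "M s = ln (cosh (\<alpha> * s)) \<longleftrightarrow> s = 0 \<or> (\<forall>i\<in>{1..n}. t i \<noteq> 0 \<longrightarrow> \<bar>\<alpha>\<bar> = \<bar>\<alpha>s i\<bar>)"
      unfolding M_def using assms(2)
      by (intro mean_ln_cosh_le[OF finite_atLeastAtMost _ assms(3) le s(1)]; simp)+
    show "(\<Prod>i=1..n. gen_cheb (\<alpha>s i) x powr t i) \<le> gen_cheb \<alpha> x"
      unfolding s(2) lhs[OF s(1)] rhs[OF s(1)] exp_le_cancel_iff by (rule mean(1))
    have "x = 1 \<longleftrightarrow> s = 0" using s by simp
    then show "(\<Prod>i=1..n. gen_cheb (\<alpha>s i) x powr t i) = gen_cheb \<alpha> x \<longleftrightarrow>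
        x = 1 \<or> (\<forall>i\<in>{1..n}. t i \<noteq> 0 \<longrightarrow> \<bar>\<alpha>\<bar> = \<bar>\<alpha>s i\<bar>)"
      unfolding s(2) lhs[OF s(1)] rhs[OF s(1)] exp_inj_iff using mean(2) by simp
  next
    assume H: "\<forall>x\<ge>1. (\<Prod>i=1..n. gen_cheb (\<alpha>s i) x powr t i) \<le> gen_cheb \<alpha> x"
    show "(\<Sum>i=1..n. t i * (\<alpha>s i)\<^sup>2) \<le> \<alpha>\<^sup>2"
    proof (rule squares_le_of_mean_ln_cosh_le)
      fix s :: real assume "s > 0"
      then have "exp (M s) \<le> exp (ln (cosh (\<alpha> * s)))"
        using H[rule_format, of "cosh s"] by (simp only: lhs rhs cosh_real_ge_1 less_imp_le)
      then show "(\<Sum>i=1..n. t i * ln (cosh (\<alpha>s i * s))) \<le> ln (cosh (\<alpha> * s))"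
        by (simp only: M_def exp_le_cancel_iff)
    qed
  qed
qed

end
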